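(* Let $G$ be the graph consisting of two distinct vertices $v,w$ and four internally vertex-disjoint paths between $v$ and $w$, where three of the paths consist of $26$ edges each and the fourth path consists of a single edge. Let $\mathrm{M}$ be the graphic matroid of $G$, let $r$ be the rank of $\mathrm{M}$, and let $W_i$ denote the number of flats of $\mathrm{M}$ of rank $i$. Then the sequence $W_0,\dots,W_r$ is not log-concave: there exists an integer $i$ with $1\le i\le r-1$ such that $W_i^2 < W_{i-1}W_{i+1}$.
   Context: The graphic matroid of a graph $G$ is the matroid on the edge set of $G$ whose independent sets are the edge sets of forests in $G$. A flat of a matroid is a subset $F$ of the ground set such that adding any element outside $F$ strictly increases the rank. *)

theory Defs
  imports "HOL-Library.Disjoint_Sets"
begin

text \<open>
  Finite simple undirected graphs: an edge is the two-element set of its endpoints. A path or a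
  cycle is given by the list of the vertices it visits.
\<close>

record 'a ugraph =
  verts :: "'a set"
  edges :: "'a set set"

definition path_edges :: "'a list \<Rightarrow> 'a set set" where
  "path_edges p = {{p ! i, p ! Suc i} | i. Suc i < length p}"

definition path_between :: "'a \<Rightarrow> 'a \<Rightarrow> 'a list \<Rightarrow> bool" where
  "path_between v w p \<longleftrightarrow> p \<noteq> [] \<and> distinct p \<and> hd p = v \<and> last p = w"

definition path_length :: "'a list \<Rightarrow> nat" where
  "path_length p = length p - 1"

definition internal_verts :: "'a list \<Rightarrow> 'a set" where
  "internal_verts p = set p - {hd p, last p}"

definition graph_of_paths :: "'a list set \<Rightarrow> 'a ugraph" where
  "graph_of_paths ps = \<lparr>verts = (\<Union>p\<in>ps. set p), edges = (\<Union>p\<in>ps. path_edges p)\<rparr>"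

text \<open>
  The list of a cycle does not repeat its starting vertex, hence the edge closing it up has to be
  added. The bound on the length excludes walking back and forth along a single edge.
\<close>

definition cycle_in :: "'a ugraph \<Rightarrow> 'a list \<Rightarrow> bool" where
  "cycle_in G c \<longleftrightarrow> length c \<ge> 3 \<and> distinct c \<and> set c \<subseteq> verts G \<and> path_edges (c @ [hd c]) \<subseteq> edges G"

definition forest :: "'a ugraph \<Rightarrow> bool" where
  "forest G \<longleftrightarrow> (\<nexists>c. cycle_in G c)"

text \<open>
  A matroid is represented by its ground set and the family of its independent sets. The matroid
  axioms are not built into the type; rank and flats are defined from the independent sets alone.
\<close>

record 'e matroid =
  ground :: "'e set"
  indep_sets :: "'e set set"

definition matroid_rank :: "'e matroid \<Rightarrow> 'e set \<Rightarrow> nat" where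
  "matroid_rank M S = Max (card ` {I \<in> indep_sets M. I \<subseteq> S})"

definition flat :: "'e matroid \<Rightarrow> 'e set \<Rightarrow> bool" where
  "flat M F \<longleftrightarrow> F \<subseteq> ground M \<and>
     (\<forall>x \<in> ground M - F. matroid_rank M F < matroid_rank M (insert x F))"

definition num_flats :: "'e matroid \<Rightarrow> nat \<Rightarrow> nat" where
  "num_flats M i = card {F. flat M F \<and> matroid_rank M F = i}"

definition graphic_matroid :: "'a ugraph \<Rightarrow> 'a set matroid" where
  "graphic_matroid G =
     \<lparr>ground = edges G,
      indep_sets = {F. F \<subseteq> edges G \<and> forest \<lparr>verts = verts G, edges = F\<rparr>}\<rparr>"

end

theory Submission
  imports Defs "HOL-Library.FuncSet"
begin

text \<open>
  Every cycle of \<open>G\<close> is the union of two of the four paths, so a set of edges is independent iff it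
  contains at most one of the paths completely. Hence a set \<open>S\<close> that contains \<open>t\<close> of the
  paths has rank \<open>card S - (t - 1)\<close> (truncated at \<open>t = 0\<close>), and it is a flat iff \<open>t = 0\<close> or \<open>S\<close> omits exactly
  one edge of no path. Counting flats by the numbers of edges they omit from each path gives
  \<open>W 73 = 52954525\<close>, \<open>W 74 = 983775\<close>, \<open>W 75 = 18551\<close>,
  and log-concavity fails at \<open>74\<close>, two below the top rank.
\<close>

section \<open>Matroids whose circuits are the unions of two distinct parts of a partition\<close>

text \<open>Only the partition of the edges into paths matters for ranks and flats, so the counting
  is done without graphs. Independence means that at most one part is contained completely.\<close>

locale theta_matroid =
  fixes K :: "'i set" and A :: "'i \<Rightarrow> 'e set" and M :: "'e matroid"
  assumes finite_index: "finite K"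
    and finite_part: "\<And>k. k \<in> K \<Longrightarrow> finite (A k)"
    and part_nonempty: "\<And>k. k \<in> K \<Longrightarrow> A k \<noteq> {}"
    and disjoint_parts: "disjoint_family_on A K"
    and ground_eq: "ground M = (\<Union>k\<in>K. A k)"
    and indep_sets_eq: "indep_sets M =
      {I. I \<subseteq> (\<Union>k\<in>K. A k) \<and> (\<forall>j\<in>K. \<forall>k\<in>K. A j \<subseteq> I \<longrightarrow> A k \<subseteq> I \<longrightarrow> j = k)}"
begin

definition full_parts :: "'e set \<Rightarrow> 'i set" where
  "full_parts S = {k \<in> K. A k \<subseteq> S}"

lemma finite_ground: "finite (ground M)"
  using finite_index finite_part ground_eq by simp

lemma card_ground: "card (ground M) = (\<Sum>k\<in>K. card (A k))"
  using card_UN_disjoint[OF finite_index, of A] finite_part disjoint_parts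
  by (simp add: ground_eq disjoint_family_on_def)

lemma part_unique: "j \<in> K \<Longrightarrow> k \<in> K \<Longrightarrow> x \<in> A j \<Longrightarrow> x \<in> A k \<Longrightarrow> j = k"
  using disjoint_parts by (auto simp: disjoint_family_on_def)

lemma finite_full_parts: "finite (full_parts S)"
  using finite_index by (simp add: full_parts_def)

text \<open>Every part that is full in \<open>S\<close> but not in \<open>I\<close> has an element
  missing from \<open>I\<close>, and disjointness makes these elements distinct. This is the price
  of breaking up full parts.\<close>

lemma card_full_parts_Diff_le:
  assumes "finite S"
  shows "card (full_parts S - full_parts I) \<le> card (S - I)"
proof -
  have "\<exists>x. x \<in> A k - I" if "k \<in> full_parts S - full_parts I" for k
    using that by (auto simp: full_parts_def)
  then obtain f where f: "\<And>k. k \<in> full_parts S - full_parts I \<Longrightarrow> f k \<in> A k - I"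
    by metis
  have "inj_on f (full_parts S - full_parts I)"
    by (rule inj_onI) (metis Diff_iff f full_parts_def mem_Collect_eq part_unique)
  moreover have "f ` (full_parts S - full_parts I) \<subseteq> S - I"
    using f by (fastforce simp: full_parts_def)
  ultimately show ?thesis
    using assms by (meson card_inj_on_le finite_Diff)
qed

lemma card_full_parts_le:
  assumes "finite S"
  shows "card (full_parts S) \<le> card S"
proof -
  have "full_parts {} = {}"
    using part_nonempty by (auto simp: full_parts_def)
  then show ?thesis
    using card_full_parts_Diff_le[OF assms, of "{}"] by simp
qed

text \<open>An independent subset keeps at most one full part, so it loses an element in each of the
  others. Conversely, deleting one element from all full parts but one suffices. Truncated
  subtraction covers the case without full parts.\<close>

lemma rank_eq:
  assumes S: "S \<subseteq> ground M"
  shows "matroid_rank M S = card S - (card (full_parts S) - 1)"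
proof -
  have finS: "finite S"
    using S finite_ground finite_subset by blast
  have upper: "card I \<le> card S - (card (full_parts S) - 1)"
    if I: "I \<in> indep_sets M" "I \<subseteq> S" for I
  proof -
    have "card (full_parts I) \<le> Suc 0"
      using I(1) finite_full_parts[of I]
      by (subst card_le_Suc0_iff_eq) (auto simp: indep_sets_eq full_parts_def)
    moreover have "card (full_parts S) - card (full_parts I) \<le> card (full_parts S - full_parts I)"
      using diff_card_le_card_Diff finite_full_parts by blast
    moreover have "card (S - I) = card S - card I"
      using I(2) finS by (simp add: card_Diff_subset finite_subset)
    moreover have "card I \<le> card S"
      using I(2) finS by (simp add: card_mono)
    ultimately show ?thesis
      using card_full_parts_Diff_le[OF finS, of I] by linarith
  qed
  have "\<exists>I. I \<in> indep_sets M \<and> I \<subseteq> S \<and> card I = card S - (card (full_parts S) - 1)"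
  proof (cases "full_parts S = {}")
    case True
    then have "S \<in> indep_sets M"
      using S by (auto simp: indep_sets_eq ground_eq full_parts_def)
    with True show ?thesis by auto
  next
    case False
    then obtain k0 where k0: "k0 \<in> full_parts S" by blast
    have "\<exists>x. x \<in> A k" if "k \<in> K" for k
      using part_nonempty[OF that] by blast
    then obtain f where f: "\<And>k. k \<in> K \<Longrightarrow> f k \<in> A k"
      by metis
    define X where "X = f ` (full_parts S - {k0})"
    have "inj_on f (full_parts S - {k0})"
      by (rule inj_onI) (metis Diff_iff f full_parts_def mem_Collect_eq part_unique)
    then have "card X = card (full_parts S) - 1"
      unfolding X_def using k0 by (simp add: card_image)
    moreover have XS: "X \<subseteq> S"
      using f by (auto simp: X_def full_parts_def)
    ultimately have "card (S - X) = card S - (card (full_parts S) - 1)"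
      using finS by (simp add: card_Diff_subset finite_subset)
    moreover have "j = k0" if "j \<in> K" "A j \<subseteq> S - X" for j
    proof (rule ccontr)
      assume "j \<noteq> k0"
      with that have "f j \<in> X" by (auto simp: X_def full_parts_def)
      with that f show False by blast
    qed
    then have "S - X \<in> indep_sets M"
      using S unfolding indep_sets_eq ground_eq by blast
    ultimately show ?thesis by blast
  qed
  then obtain I where I: "I \<in> indep_sets M" "I \<subseteq> S"
    "card I = card S - (card (full_parts S) - 1)" by blast
  have "finite {I \<in> indep_sets M. I \<subseteq> S}"
    using finS by (rule finite_subset[OF _ finite_Pow_iff[THEN iffD2], rotated]) auto
  then show ?thesis
    unfolding matroid_rank_def using I upper
    by (intro Max_eqI) (auto intro!: rev_image_eqI[of I])
qed

text \<open>Adding \<open>x\<close> fails to raise the rank exactly when \<open>x\<close> is the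
  last missing element of its part and another part is full already: the gain of one element is then
  cancelled by one more full part.\<close>

lemma flat_iff:
  "flat M F \<longleftrightarrow> F \<subseteq> ground M \<and> (full_parts F = {} \<or> (\<forall>k\<in>K. card (A k - F) \<noteq> 1))"
proof (cases "F \<subseteq> ground M")
  case F: True
  then have finF: "finite F"
    using finite_ground finite_subset by blast
  have rank_insert: "matroid_rank M F < matroid_rank M (insert x F) \<longleftrightarrow>
      full_parts F = {} \<or> A k - F \<noteq> {x}"
    if k: "k \<in> K" and x: "x \<in> A k" "x \<notin> F" for k x
  proof -
    have "insert x F \<subseteq> ground M"
      using F k x by (auto simp: ground_eq)
    note ranks = rank_eq[OF this] rank_eq[OF F]
    \<comment> \<open>By disjointness \<open>x\<close> can complete no part other than
      \<open>A k\<close>.\<close>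
    have "full_parts (insert x F) = (if A k - F = {x} then insert k (full_parts F) else full_parts F)"
      using k x part_unique by (auto simp: full_parts_def)
    moreover have "k \<notin> full_parts F"
      using x by (auto simp: full_parts_def)
    moreover have "card (full_parts F) > 0 \<longleftrightarrow> full_parts F \<noteq> {}"
      using finite_full_parts by (simp add: card_gt_0_iff)
    \<comment> \<open>\<open>card_full_parts_le\<close> ensures that the outer subtraction in
      \<open>rank_eq\<close> does not truncate.\<close>
    ultimately show ?thesis
      using ranks card_full_parts_le[OF finF] finF x(2) finite_full_parts[of F]
      by (cases "A k - F = {x}"; cases "full_parts F = {}") simp_all
  qed
  have "flat M F \<longleftrightarrow> (\<forall>k\<in>K. \<forall>x\<in>A k - F. matroid_rank M F < matroid_rank M (insert x F))"
    using F by (auto simp: flat_def ground_eq)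
  also have "\<dots> \<longleftrightarrow> (\<forall>k\<in>K. \<forall>x\<in>A k - F. full_parts F = {} \<or> A k - F \<noteq> {x})"
    by (intro ball_cong refl rank_insert) auto
  also have "\<dots> \<longleftrightarrow> full_parts F = {} \<or> (\<forall>k\<in>K. card (A k - F) \<noteq> 1)"
    by (auto simp: card_1_singleton_iff)
  finally show ?thesis using F by simp
qed (simp add: flat_def)

lemma full_parts_eq: "full_parts F = {k \<in> K. card (A k - F) = 0}"
  using finite_part by (auto simp: full_parts_def)

text \<open>With \<open>t\<close> full parts the rank is \<open>card F - t\<close>, plus one if
  \<open>t > 0\<close>. Each full part misses nothing, so \<open>max 1\<close> supplies the term
  \<open>t\<close>, and \<open>of_bool\<close> supplies the extra one. The additive form avoids
  truncated subtraction.\<close>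

lemma rank_add_sum:
  assumes F: "F \<subseteq> ground M"
  shows "matroid_rank M F + (\<Sum>k\<in>K. max 1 (card (A k - F))) =
    card (ground M) + of_bool (\<exists>k\<in>K. card (A k - F) = 0)"
proof -
  have finF: "finite F"
    using F finite_ground finite_subset by blast
  have "card (ground M - F) = (\<Sum>k\<in>K. card (A k - F))"
  proof -
    have "ground M - F = (\<Union>k\<in>K. A k - F)" by (auto simp: ground_eq)
    moreover have "\<forall>i\<in>K. \<forall>j\<in>K. i \<noteq> j \<longrightarrow> (A i - F) \<inter> (A j - F) = {}"
      using part_unique by blast
    moreover have "\<forall>i\<in>K. finite (A i - F)"
      using finite_part by simp
    ultimately show ?thesis
      using card_UN_disjoint[OF finite_index, of "\<lambda>k. A k - F"] by simp
  qed
  moreover have "card (ground M - F) + card F = card (ground M)"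
    using F finF finite_ground by (metis add.commute card_Diff_subset card_mono le_add_diff_inverse)
  moreover have "(\<Sum>k\<in>K. max 1 (card (A k - F))) = (\<Sum>k\<in>K. card (A k - F)) + card (full_parts F)"
  proof -
    have "card (full_parts F) = (\<Sum>k\<in>K. of_bool (card (A k - F) = 0))"
      using finite_index by (simp add: full_parts_eq of_bool_def sum.If_cases Int_def)
    moreover have "max 1 n = n + of_bool (n = 0)" for n :: nat by auto
    ultimately show ?thesis by (simp add: sum.distrib)
  qed
  moreover have "card (full_parts F) = 0 \<longleftrightarrow> \<not> (\<exists>k\<in>K. card (A k - F) = 0)"
    using finite_full_parts by (auto simp: full_parts_eq)
  ultimately show ?thesis
    using rank_eq[OF F] card_full_parts_le[OF finF] by (auto simp: of_bool_def)
qed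

text \<open>A subset of the ground set amounts to an independent choice of the missing elements in
  each part.\<close>

lemma card_prescribed_complements:
  "card {F. F \<subseteq> ground M \<and> (\<forall>k\<in>K. card (A k - F) = n k)} = (\<Prod>k\<in>K. card (A k) choose n k)"
proof -
  let ?S = "{F. F \<subseteq> ground M \<and> (\<forall>k\<in>K. card (A k - F) = n k)}"
  let ?T = "PiE K (\<lambda>k. {X. X \<subseteq> A k \<and> card X = n k})"
  have "bij_betw (\<lambda>F. \<lambda>k\<in>K. A k - F) ?S ?T"
  proof (rule bij_betw_byWitness[where f' = "\<lambda>X. ground M - (\<Union>k\<in>K. X k)"])
    \<comment> \<open>Disjointness keeps the sets chosen in other parts from affecting
      \<open>A k\<close>.\<close>
    have part_Diff: "A k - (ground M - (\<Union>k\<in>K. X k)) = X k" if "X \<in> ?T" "k \<in> K" for X k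
    proof -
      have "X j \<subseteq> A j" if "j \<in> K" for j
        using \<open>X \<in> ?T\<close> that by (auto simp: PiE_iff)
      then show ?thesis
        using \<open>k \<in> K\<close> part_unique by (fastforce simp: ground_eq)
    qed
    show "\<forall>F\<in>?S. ground M - (\<Union>k\<in>K. (\<lambda>k\<in>K. A k - F) k) = F"
      by (auto simp: ground_eq)
    show "\<forall>X\<in>?T. (\<lambda>k\<in>K. A k - (ground M - (\<Union>k\<in>K. X k))) = X"
    proof (intro ballI ext)
      fix X k assume X: "X \<in> ?T"
      show "(\<lambda>k\<in>K. A k - (ground M - (\<Union>k\<in>K. X k))) k = X k"
      proof (cases "k \<in> K")
        case True
        then show ?thesis
          using part_Diff[OF X True] by (simp del: Diff_Diff_Int)
      next
        case False
        then show ?thesis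
          using PiE_arb[OF X False] by simp
      qed
    qed
    show "(\<lambda>F. \<lambda>k\<in>K. A k - F) ` ?S \<subseteq> ?T" by auto
    have "ground M - (\<Union>k\<in>K. X k) \<in> ?S" if X: "X \<in> ?T" for X
    proof -
      have "card (A k - (ground M - (\<Union>k\<in>K. X k))) = n k" if "k \<in> K" for k
        unfolding part_Diff[OF X that] using X that by (simp add: PiE_iff)
      then show ?thesis by blast
    qed
    then show "(\<lambda>X. ground M - (\<Union>k\<in>K. X k)) ` ?T \<subseteq> ?S" by blast
  qed
  then have "card ?S = card ?T" by (rule bij_betw_same_card)
  then show ?thesis
    using finite_index finite_part by (simp add: card_PiE n_subsets)
qed

end

section \<open>Edges of paths and cycles given as vertex lists\<close>

lemma path_edges_simps [simp]:
  "path_edges [] = {}"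
  "path_edges [x] = {}"
  "path_edges (x # y # p) = insert {x, y} (path_edges (y # p))"
proof -
  show "path_edges (x # y # p) = insert {x, y} (path_edges (y # p))"
  proof (intro equalityI subsetI)
    fix e assume "e \<in> path_edges (x # y # p)"
    then obtain i where "e = {(x # y # p) ! i, (y # p) ! i}" "i < length (y # p)"
      by (auto simp: path_edges_def)
    then show "e \<in> insert {x, y} (path_edges (y # p))"
      by (cases i) (auto simp: path_edges_def)
  next
    fix e assume "e \<in> insert {x, y} (path_edges (y # p))"
    then consider "e = {x, y}" | i where "e = {(y # p) ! i, p ! i}" "i < length p"
      by (auto simp: path_edges_def)
    then show "e \<in> path_edges (x # y # p)"
    proof cases
      case 1
      then show ?thesis unfolding path_edges_def by (auto intro!: exI[of _ 0])
    next
      case 2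
      then show ?thesis unfolding path_edges_def by (auto intro!: exI[of _ "Suc i"])
    qed
  qed
qed (auto simp: path_edges_def)

text \<open>The vertex \<open>x\<close> is repeated at the cut so that no edge is lost.\<close>

lemma path_edges_append:
  "path_edges (p @ x # q) = path_edges (p @ [x]) \<union> path_edges (x # q)"
proof (induction p)
  case (Cons y p)
  then show ?case by (cases p) auto
qed simp

text \<open>Edges are unordered; this allows the return along a second path when a cycle is
  built.\<close>

lemma path_edges_rev: "path_edges (rev p) = path_edges p"
proof (induction p rule: induct_list012)
  case (3 x y p)
  then show ?case
    using path_edges_append[of "rev p" y "[x]"] by (simp add: insert_commute)
qed auto

lemma path_edges_subset_set: "e \<in> path_edges p \<Longrightarrow> e \<subseteq> set p"
  by (auto simp: path_edges_def)

lemma finite_path_edges: "finite (path_edges p)"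
  by (induction p rule: induct_list012) auto

lemma card_path_edges: "distinct p \<Longrightarrow> card (path_edges p) = path_length p"
proof (induction p rule: induct_list012)
  case (3 x y p)
  then have "{x, y} \<notin> path_edges (y # p)"
    using path_edges_subset_set[of "{x, y}" "y # p"] by auto
  then show ?case
    using 3 by (simp add: path_length_def finite_path_edges)
qed (auto simp: path_length_def)

text \<open>Bounds degrees along a path: at most two edges at any vertex, at most one at an
  end.\<close>

lemma path_edges_at_nth:
  assumes "distinct p" "i < length p" "e \<in> path_edges p" "p ! i \<in> e"
  shows "0 < i \<and> e = {p ! (i - 1), p ! i} \<or> Suc i < length p \<and> e = {p ! i, p ! Suc i}"
proof -
  obtain j where j: "e = {p ! j, p ! Suc j}" "Suc j < length p"
    using assms(3) by (auto simp: path_edges_def)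
  with assms have "i = j \<or> i = Suc j"
    by (auto simp: nth_eq_iff_index_eq)
  with j show ?thesis by auto
qed

text \<open>The two edges lead to the cyclic predecessor and successor of \<open>x\<close>, which
  differ since the length is at least 3.\<close>

lemma cycle_degree:
  assumes "length c \<ge> 3" "distinct c" "x \<in> set c"
  obtains d e where "d \<in> path_edges (c @ [hd c])" "e \<in> path_edges (c @ [hd c])"
    "d \<noteq> e" "x \<in> d" "x \<in> e"
proof -
  define n where "n = length c"
  have n: "n \<ge> 3" using assms by (simp add: n_def)
  obtain i where i: "i < n" "x = c ! i"
    using assms(3) by (auto simp: in_set_conv_nth n_def)
  \<comment> \<open>Indices modulo \<open>n\<close> treat the closing edge like the others.\<close>
  have edge: "{c ! j, c ! (Suc j mod n)} \<in> path_edges (c @ [hd c])" if "j < n" for j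
  proof -
    have "c ! (Suc j mod n) = (c @ [hd c]) ! Suc j"
    proof (cases "Suc j = n")
      case True
      then show ?thesis using n by (cases c) (auto simp: n_def nth_append)
    qed (use that in \<open>simp add: n_def nth_append\<close>)
    moreover have "c ! j = (c @ [hd c]) ! j"
      using that by (simp add: n_def nth_append)
    ultimately show ?thesis
      using that by (auto simp: path_edges_def n_def)
  qed
  \<comment> \<open>The cyclic predecessor of \<open>i\<close>; the case \<open>i = 0\<close> is
    separate because \<open>0 - 1 = 0\<close> on naturals.\<close>
  define h where "h = (if i = 0 then n - 1 else i - 1)"
  have h: "h < n" "Suc h mod n = i" "h \<noteq> i" "h \<noteq> Suc i mod n"
    using i n by (auto simp: h_def mod_Suc)
  have "c ! h \<noteq> c ! i" "c ! h \<noteq> c ! (Suc i mod n)"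
    using h i n assms(2) nth_eq_iff_index_eq[of c h i] nth_eq_iff_index_eq[of c h "Suc i mod n"]
    by (auto simp flip: n_def)
  then have "{c ! h, c ! i} \<noteq> {c ! i, c ! (Suc i mod n)}"
    by auto
  then show ?thesis
    using edge[of h] edge[of i] h i that by auto
qed

section \<open>Cycles in a union of internally disjoint paths with common ends\<close>

text \<open>Edges are vertex sets, so two paths of length 1 would share the edge
  \<open>{v, w}\<close>; \<open>single_edge_unique\<close> rules this out.\<close>

locale theta_graph =
  fixes K :: "'i set" and P :: "'i \<Rightarrow> 'a list" and v w :: 'a
  assumes ends_distinct: "v \<noteq> w"
    and paths: "\<And>k. k \<in> K \<Longrightarrow> path_between v w (P k)"
    and disjoint_internal: "disjoint_family_on (\<lambda>k. internal_verts (P k)) K"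
    and single_edge_unique:
      "\<And>j k. \<lbrakk>j \<in> K; k \<in> K; path_length (P j) = 1; path_length (P k) = 1\<rbrakk> \<Longrightarrow> j = k"
begin

lemma path_decomp:
  assumes "k \<in> K"
  obtains m where "P k = v # m @ [w]" "distinct (v # m @ [w])"
    "internal_verts (P k) = set m" "path_length (P k) = Suc (length m)"
proof -
  have p: "P k \<noteq> []" "distinct (P k)" "hd (P k) = v" "last (P k) = w"
    using paths[OF assms] by (auto simp: path_between_def)
  then obtain q where q: "P k = v # q" by (cases "P k") auto
  with p ends_distinct have "q \<noteq> []" "last q = w" by auto
  then have "q = butlast q @ [w]" by (metis append_butlast_last_id)
  with q have m: "P k = v # butlast q @ [w]" by simp
  show thesis
  proof (rule that[OF m])
    show d: "distinct (v # butlast q @ [w])" using p m by simp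
    then show "internal_verts (P k) = set (butlast q)"
      unfolding m by (auto simp: internal_verts_def)
  qed (simp add: m path_length_def)
qed

lemma internal_unique:
  "j \<in> K \<Longrightarrow> k \<in> K \<Longrightarrow> x \<in> internal_verts (P j) \<Longrightarrow> x \<in> set (P k) \<Longrightarrow> j = k"
proof (rule ccontr)
  assume *: "j \<in> K" "k \<in> K" "x \<in> internal_verts (P j)" "x \<in> set (P k)" "j \<noteq> k"
  then have "x \<notin> internal_verts (P k)"
    using disjoint_internal by (auto simp: disjoint_family_on_def)
  with * show False
    using paths by (auto simp: internal_verts_def path_between_def)
qed

lemma internal_edge:
  assumes "j \<in> K" "k \<in> K" "x \<in> internal_verts (P j)" "e \<in> path_edges (P k)" "x \<in> e"
  shows "j = k"
  using assms internal_unique path_edges_subset_set by blast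

lemma nth_internal:
  assumes "k \<in> K" "0 < i" "Suc i < length (P k)"
  shows "P k ! i \<in> internal_verts (P k)"
proof -
  obtain m where "P k = v # m @ [w]" "internal_verts (P k) = set m"
    using assms(1) by (rule path_decomp)
  with assms show ?thesis by (cases i) (auto simp: nth_append)
qed

text \<open>A shared edge contains no internal vertex, so it joins the two ends and is the whole of
  both paths. Then both have length 1.\<close>

lemma disjoint_path_edges: "disjoint_family_on (\<lambda>k. path_edges (P k)) K"
proof -
  have single: "path_length (P j) = 1"
    if jk: "j \<in> K" "k \<in> K" "j \<noteq> k" and e: "e \<in> path_edges (P j)" "e \<in> path_edges (P k)" for j k e
  proof -
    obtain i where i: "e = {P j ! i, P j ! Suc i}" "Suc i < length (P j)"
      using e(1) by (auto simp: path_edges_def)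
    have "x \<notin> internal_verts (P j)" if "x \<in> e" for x
      using internal_edge[OF jk(1,2) _ e(2) that] jk(3) by blast
    \<comment> \<open>An endpoint of the edge that is not internal must be an end of the list, so
      the edge is both first and last.\<close>
    then have "\<not> 0 < i" "\<not> Suc (Suc i) < length (P j)"
      using nth_internal[OF jk(1), of i] nth_internal[OF jk(1), of "Suc i"] i by auto
    with i(2) have "i = 0" "Suc i = length (P j) - 1"
      by linarith+
    then show ?thesis by (simp add: path_length_def)
  qed
  show ?thesis
    unfolding disjoint_family_on_def using single single_edge_unique by blast
qed

lemma path_edges_nonempty: "k \<in> K \<Longrightarrow> path_edges (P k) \<noteq> {}"
  by (metis Suc_not_Zero card.empty card_path_edges path_between_def path_decomp paths)

lemma two_paths_cycle:
  assumes jk: "j \<in> K" "k \<in> K" "j \<noteq> k"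
    and sub: "path_edges (P j) \<subseteq> F" "path_edges (P k) \<subseteq> F"
  shows "\<exists>c. cycle_in \<lparr>verts = (\<Union>k\<in>K. set (P k)), edges = F\<rparr> c"
proof -
  obtain m where m: "P j = v # m @ [w]" "distinct (v # m @ [w])"
    "internal_verts (P j) = set m" "path_length (P j) = Suc (length m)"
    using jk(1) by (rule path_decomp)
  obtain n where n: "P k = v # n @ [w]" "distinct (v # n @ [w])"
    "internal_verts (P k) = set n" "path_length (P k) = Suc (length n)"
    using jk(2) by (rule path_decomp)
  \<comment> \<open>Along \<open>P j\<close> from \<open>v\<close> to \<open>w\<close>, then back
    along \<open>P k\<close>; the final \<open>v\<close> is omitted because cycle lists do not
    repeat their start.\<close>
  define c where "c = v # m @ w # rev n"
  \<comment> \<open>At most one of the paths is a single edge, so some internal vertex brings the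
    length to 3.\<close>
  have "m \<noteq> [] \<or> n \<noteq> []"
    using single_edge_unique[OF jk(1,2)] jk(3) m n by auto
  then have "length c \<ge> 3"
    by (cases m; cases n) (auto simp: c_def)
  moreover have "set m \<inter> set n = {}"
    using disjoint_family_onD[OF disjoint_internal jk] m(3) n(3) by simp
  then have "distinct c"
    using m n by (auto simp: c_def)
  moreover have "set c \<subseteq> (\<Union>k\<in>K. set (P k))"
  proof -
    have "set c = set (P j) \<union> set (P k)"
      unfolding c_def m(1) n(1) by auto
    then show ?thesis using jk by blast
  qed
  moreover have "path_edges (c @ [hd c]) = path_edges (P j) \<union> path_edges (rev (P k))"
    using path_edges_append[of "v # m" w "rev n @ [v]"] by (simp add: c_def m(1) n(1))
  then have "path_edges (c @ [hd c]) \<subseteq> F"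
    using sub by (simp add: path_edges_rev)
  ultimately show ?thesis
    by (auto simp: cycle_in_def)
qed

text \<open>A cycle cannot leave a path at an internal vertex, so it contains every path of which it
  uses an edge. Hence it passes through \<open>v\<close>, where its two edges belong to different
  paths.\<close>

lemma cycle_contains_two_paths:
  assumes c: "cycle_in \<lparr>verts = V, edges = F\<rparr> c" and F: "F \<subseteq> (\<Union>k\<in>K. path_edges (P k))"
  shows "\<exists>j\<in>K. \<exists>k\<in>K. j \<noteq> k \<and> path_edges (P j) \<subseteq> F \<and> path_edges (P k) \<subseteq> F"
proof -
  define C where "C = path_edges (c @ [hd c])"
  have len: "length c \<ge> 3" and dist: "distinct c" and CF: "C \<subseteq> F"
    using c by (auto simp: cycle_in_def C_def)
  have inc: "x \<in> set c" if "e \<in> C" "x \<in> e" for e x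
    using path_edges_subset_set[of e "c @ [hd c]"] that len by (cases c) (auto simp: C_def)
  have CE: "\<exists>k\<in>K. e \<in> path_edges (P k)" if "e \<in> C" for e
    using that CF F by blast
  have distP: "distinct (P k)" if "k \<in> K" for k
    using paths[OF that] by (simp add: path_between_def)
  \<comment> \<open>If either edge is in \<open>C\<close>, then \<open>P k ! i\<close> lies on the
    cycle, and the two cycle edges there can only be these two.\<close>
  have step: "{P k ! i, P k ! Suc i} \<in> C \<longleftrightarrow> {P k ! (i - 1), P k ! i} \<in> C"
    if k: "k \<in> K" and i: "0 < i" "Suc i < length (P k)" for k i
  proof -
    have "{P k ! i, P k ! Suc i} \<in> C \<and> {P k ! (i - 1), P k ! i} \<in> C"
      if x: "P k ! i \<in> set c"
    proof -
      obtain d e where de: "d \<in> C" "e \<in> C" "d \<noteq> e" "P k ! i \<in> d" "P k ! i \<in> e"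
        using cycle_degree[OF len dist x] unfolding C_def by metis
      have "f = {P k ! (i - 1), P k ! i} \<or> f = {P k ! i, P k ! Suc i}" if "f \<in> C" "P k ! i \<in> f" for f
      proof -
        have "f \<in> path_edges (P k)"
          using CE[OF that(1)] internal_edge[OF k _ nth_internal[OF k i] _ that(2)] by blast
        then show ?thesis
          using path_edges_at_nth[OF distP[OF k] _ _ that(2)] i by auto
      qed
      with de show ?thesis by metis
    qed
    then show ?thesis using inc by blast
  qed
  have first: "{P k ! i, P k ! Suc i} \<in> C \<longleftrightarrow> {P k ! 0, P k ! 1} \<in> C"
    if "k \<in> K" "Suc i < length (P k)" for k i
    using that(2)
  proof (induction i)
    case (Suc i)
    then show ?case using step[OF that(1), of "Suc i"] by simp
  qed simp
  have all: "path_edges (P k) \<subseteq> C" if "k \<in> K" "e \<in> C" "e \<in> path_edges (P k)" for k e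
    using first[OF that(1)] that(2,3) by (auto simp: path_edges_def)
  have hdP: "P k ! 0 = v" "0 < length (P k)" if k: "k \<in> K" for k
    using path_decomp[OF k] by fastforce+
  \<comment> \<open>Some edge of the cycle lies on a path, which is then contained in
    \<open>C\<close> together with its initial edge at \<open>v\<close>.\<close>
  have v: "v \<in> set c"
  proof -
    obtain x where "x \<in> set c" using len by (cases c) auto
    then obtain e where e: "e \<in> C" using cycle_degree[OF len dist] C_def by metis
    then obtain k where k: "k \<in> K" "path_edges (P k) \<subseteq> C" using CE all by blast
    obtain m where "P k = v # m @ [w]" using k(1) by (rule path_decomp)
    then obtain y where "{v, y} \<in> path_edges (P k)" by (cases m) auto
    then show ?thesis using inc k by blast
  qed
  obtain d e where de: "d \<in> C" "e \<in> C" "d \<noteq> e" "v \<in> d" "v \<in> e"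
    using cycle_degree[OF len dist v] unfolding C_def by metis
  obtain j k where jk: "j \<in> K" "d \<in> path_edges (P j)" "k \<in> K" "e \<in> path_edges (P k)"
    using CE de by metis
  have at_v: "f = {P k ! 0, P k ! 1}" if "k \<in> K" "f \<in> path_edges (P k)" "v \<in> f" for f k
    using path_edges_at_nth[OF distP, of k 0 f] that hdP[of k] by auto
  \<comment> \<open>Each path has only one edge at \<open>v\<close>.\<close>
  have "j \<noteq> k"
    using at_v de jk by metis
  then show ?thesis
    using jk all de CF by (meson subset_trans)
qed

text \<open>Puts graphic independence into the form required by
  \<open>theta_matroid\<close>.\<close>

lemma forest_iff:
  assumes "F \<subseteq> (\<Union>k\<in>K. path_edges (P k))"
  shows "forest \<lparr>verts = (\<Union>k\<in>K. set (P k)), edges = F\<rparr> \<longleftrightarrow>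
    (\<forall>j\<in>K. \<forall>k\<in>K. path_edges (P j) \<subseteq> F \<longrightarrow> path_edges (P k) \<subseteq> F \<longrightarrow> j = k)"
  unfolding forest_def
  using two_paths_cycle cycle_contains_two_paths[OF _ assms] by metis

end

section \<open>Counting flats near the top rank by profiles\<close>

text \<open>
  The profile \<open>(a, b, c, d)\<close> of a flat counts the edges that the flat misses in each of the four
  paths; \<open>max 1\<close> and the two conditions come from \<open>rank_add_sum\<close> and \<open>flat_iff\<close>. Profiles with an
  entry above \<open>4\<close> only occur for ranks below \<open>73\<close>, so the truncated ranges are
  correct for the three ranks needed.
\<close>

definition profile_count :: "nat \<Rightarrow> nat" where
  "profile_count i = (\<Sum>a\<le>4. \<Sum>b\<le>4. \<Sum>c\<le>4. \<Sum>d\<le>4.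
     if (0 \<notin> {a, b, c, d} \<or> 1 \<notin> {a, b, c, d}) \<and>
        i + (max 1 a + max 1 b + max 1 c + max 1 d) = 79 + of_bool (0 \<in> {a, b, c, d})
     then (26 choose a) * (26 choose b) * (26 choose c) * (1 choose d) else 0)"

text \<open>Rank and flatness depend only on the profile, so the flats split into the fibres of
  \<open>profile\<close>, each counted by a product of binomials.\<close>

lemma num_flats_eq_profile_count:
  assumes "theta_matroid {..<4::nat} A M"
    and card_A: "card (A 0) = 26" "card (A 1) = 26" "card (A 2) = 26" "card (A 3) = 1"
    and i: "73 \<le> i"
  shows "num_flats M i = profile_count i"
proof -
  interpret theta_matroid "{..<4::nat}" A M by fact
  have four: "{..<4::nat} = {0, 1, 2, 3}" by auto
  \<comment> \<open>\<open>79 = 3 * 26 + 1\<close>.\<close>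
  have card_79: "card (ground M) = 79"
    using card_A by (simp add: card_ground four)
  define good where "good = (\<lambda>(a, b, c, d).
    (0 \<notin> {a, b, c, d} \<or> 1 \<notin> {a, b, c, d}) \<and>
    i + (max 1 a + max 1 b + max 1 c + max 1 d) = 79 + of_bool (0 \<in> {a, b, c, d::nat}))"
  define Q where "Q = {q \<in> {..4} \<times> {..4} \<times> {..4} \<times> {..4::nat}. good q}"
  define profile where
    "profile F = (card (A 0 - F), card (A 1 - F), card (A 2 - F), card (A 3 - F))" for F
  \<comment> \<open>The four \<open>max\<close> terms add up to at most \<open>80 - 73 = 7\<close>;
    three of them are at least 1, so the remaining one is at most 4.\<close>
  have bounds: "a \<le> 4 \<and> b \<le> 4 \<and> c \<le> 4 \<and> d \<le> 4" if "good (a, b, c, d)" for a b c d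
  proof -
    have "i + (max 1 a + max 1 b + max 1 c + max 1 d) \<le> 80"
      using that by (simp add: good_def of_bool_def)
    with i show ?thesis by linarith
  qed
  then have in_Q: "good q \<longleftrightarrow> q \<in> Q" for q
    by (cases q) (auto simp: Q_def)
  have flat_rank: "flat M F \<and> matroid_rank M F = i \<longleftrightarrow> profile F \<in> Q" if "F \<subseteq> ground M" for F
  proof -
    obtain a b c d where abcd: "profile F = (a, b, c, d)"
      by (cases "profile F")
    then have cards: "card (A 0 - F) = a" "card (A 1 - F) = b" "card (A 2 - F) = c" "card (A 3 - F) = d"
      by (simp_all add: profile_def)
    have "full_parts F = {} \<longleftrightarrow> (\<forall>k\<in>{..<4}. card (A k - F) \<noteq> 0)"
      by (auto simp: full_parts_eq Ball_def)
    then have flat: "flat M F \<longleftrightarrow> 0 \<notin> {a, b, c, d} \<or> 1 \<notin> {a, b, c, d}"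
      using that cards unfolding flat_iff by (simp add: four) blast
    have "(\<Sum>k<4. max 1 (card (A k - F))) = max 1 a + max 1 b + max 1 c + max 1 d"
      using cards by (simp add: four)
    moreover have "(\<exists>k\<in>{..<4}. card (A k - F) = 0) \<longleftrightarrow> 0 \<in> {a, b, c, d}"
      using cards by (auto simp: four)
    ultimately have rank: "matroid_rank M F + (max 1 a + max 1 b + max 1 c + max 1 d) =
        79 + of_bool (0 \<in> {a, b, c, d})"
      using rank_add_sum[OF that] by (simp only: card_79)
    have "m = i \<longleftrightarrow> i + s = t" if "m + s = t" for m s t
      using that by auto
    note rank_iff = this[OF rank]
    have "profile F \<in> Q \<longleftrightarrow> (0 \<notin> {a, b, c, d} \<or> 1 \<notin> {a, b, c, d}) \<and>
        i + (max 1 a + max 1 b + max 1 c + max 1 d) = 79 + of_bool (0 \<in> {a, b, c, d})"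
      by (simp only: in_Q[symmetric] abcd good_def prod.case)
    then show ?thesis
      by (simp only: flat rank_iff)
  qed
  have "flat M F \<Longrightarrow> F \<subseteq> ground M" for F
    by (simp add: flat_def)
  then have "{F. flat M F \<and> matroid_rank M F = i} = (\<Union>q\<in>Q. {F. F \<subseteq> ground M \<and> profile F = q})"
    using flat_rank by blast
  then have "num_flats M i = card (\<Union>q\<in>Q. {F. F \<subseteq> ground M \<and> profile F = q})"
    by (simp only: num_flats_def)
  also have "\<dots> = (\<Sum>q\<in>Q. card {F. F \<subseteq> ground M \<and> profile F = q})"
  proof (rule card_UN_disjoint)
    show "finite Q" by (simp add: Q_def)
    show "\<forall>q\<in>Q. finite {F. F \<subseteq> ground M \<and> profile F = q}"
      using finite_ground by simp
  qed blast
  also have "\<dots> = (\<Sum>(a, b, c, d)\<in>Q. (26 choose a) * (26 choose b) * (26 choose c) * (1 choose d))"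
  proof (rule sum.cong[OF refl], clarify)
    fix a b c d
    \<comment> \<open>The tuple becomes a list indexed by \<open>k\<close>, since
      \<open>card_prescribed_complements\<close> expects a function on the index set.\<close>
    have "{F. F \<subseteq> ground M \<and> profile F = (a, b, c, d)} =
        {F. F \<subseteq> ground M \<and> (\<forall>k\<in>{..<4}. card (A k - F) = [a, b, c, d] ! k)}"
      by (auto simp: profile_def four)
    then show "card {F. F \<subseteq> ground M \<and> profile F = (a, b, c, d)} =
        (26 choose a) * (26 choose b) * (26 choose c) * (1 choose d)"
      using card_A by (simp only: card_prescribed_complements) (simp add: four)
  qed
  also have "\<dots> = (\<Sum>q\<in>{..4} \<times> {..4} \<times> {..4} \<times> {..4}. if good q then
      (case q of (a, b, c, d) \<Rightarrow> (26 choose a) * (26 choose b) * (26 choose c) * (1 choose d)) else 0)"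
    unfolding Q_def by (rule sum.inter_filter) simp
  also have "\<dots> = profile_count i"
    unfolding profile_count_def sum.cartesian_product
  proof (rule sum.cong[OF refl], goal_cases)
    case (1 q)
    obtain a b c d where q: "q = (a, b, c, d)" by (cases q)
    show ?case unfolding q good_def prod.case by (rule refl)
  qed
  finally show ?thesis .
qed

text \<open>Direct evaluation: the ranges are written out, giving 625 summands for each rank, and
  the larger binomials are supplied.\<close>

lemma profile_count_values:
  "profile_count 73 = 52954525" "profile_count 74 = 983775" "profile_count 75 = 18551"
proof -
  have range: "{..4} = {0, 1, 2, 3, 4::nat}" by auto
  have choose: "26 choose 2 = (325::nat)" "26 choose 3 = (2600::nat)" "26 choose 4 = (14950::nat)"
    by (simp_all add: eval_nat_numeral binomial_Suc_Suc)
  show "profile_count 73 = 52954525" "profile_count 74 = 983775" "profile_count 75 = 18551"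
    by (simp_all add: profile_count_def range choose)
qed

theorem theorem2p3:
  fixes v w :: 'a and P :: "nat \<Rightarrow> 'a list"
    and G :: "'a ugraph" and M :: "'a set matroid" and r :: nat and W :: "nat \<Rightarrow> nat"
  assumes "v \<noteq> w"
    and "\<And>k. k < 4 \<Longrightarrow> path_between v w (P k)"
    and "disjoint_family_on (\<lambda>k. internal_verts (P k)) {..<4}"
    and "path_length (P 0) = 26" "path_length (P 1) = 26" "path_length (P 2) = 26"
    and "path_length (P 3) = 1"
    and "G = graph_of_paths (P ` {..<4})"
    and "M = graphic_matroid G"
    and "r = matroid_rank M (ground M)"
    and "\<And>i. W i = num_flats M i"
  shows "\<exists>i. 1 \<le> i \<and> i \<le> r - 1 \<and> (W i)\<^sup>2 < W (i - 1) * W (i + 1)"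
proof -
  have single: "k = 3" if "k < 4" "path_length (P k) = 1" for k
  proof -
    from \<open>k < 4\<close> consider "k = 0" | "k = 1" | "k = 2" | "k = 3" by linarith
    then show ?thesis
      using that(2) assms(4-6) by cases auto
  qed
  interpret theta_graph "{..<4}" P v w
  proof
    fix j k :: nat
    assume "j \<in> {..<4}" "k \<in> {..<4}" "path_length (P j) = 1" "path_length (P k) = 1"
    then show "j = k" using single[of j] single[of k] by simp
  qed (use assms(1-3) in simp_all)
  define A where "A = (\<lambda>k. path_edges (P k))"
  have G: "G = \<lparr>verts = (\<Union>k<4. set (P k)), edges = (\<Union>k<4. A k)\<rparr>"
    by (simp add: assms(8) graph_of_paths_def A_def)
  have "{F. F \<subseteq> edges G \<and> forest \<lparr>verts = verts G, edges = F\<rparr>} =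
      {F. F \<subseteq> (\<Union>k<4. A k) \<and> (\<forall>j\<in>{..<4}. \<forall>k\<in>{..<4}. A j \<subseteq> F \<longrightarrow> A k \<subseteq> F \<longrightarrow> j = k)}"
    using forest_iff unfolding A_def G by auto
  then have theta: "theta_matroid {..<4} A M"
    using disjoint_path_edges path_edges_nonempty finite_path_edges
    by unfold_locales (auto simp: A_def assms(9) graphic_matroid_def G)
  then interpret theta_matroid "{..<4}" A M .
  have card_A: "card (A 0) = 26" "card (A 1) = 26" "card (A 2) = 26" "card (A 3) = 1"
    using card_path_edges[of "P _"] assms(2,4-7) by (simp_all add: A_def path_between_def)
  have four: "{..<4::nat} = {0, 1, 2, 3}" by auto
  have "card (ground M) = 79"
    using card_A by (simp add: card_ground four)
  moreover have "card (A k - ground M) = 0" if "k \<in> {..<4}" for k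
    using that by (metis Diff_eq_empty_iff UN_upper card.empty ground_eq)
  \<comment> \<open>The full ground set misses nothing, so each \<open>max\<close> term is 1 and
    \<open>r = 79 + 1 - 4 = 76\<close>.\<close>
  then have "(\<Sum>k<4. max 1 (card (A k - ground M))) = 4" "\<exists>k\<in>{..<4}. card (A k - ground M) = 0"
    by (auto intro!: exI[of _ 0])
  ultimately have "r = 76"
    using rank_add_sum[OF order_refl] by (simp add: assms(10))
  moreover have "W 73 = 52954525" "W 74 = 983775" "W 75 = 18551"
    using num_flats_eq_profile_count[OF theta card_A]
    by (simp_all add: assms(11) profile_count_values)
  ultimately show ?thesis
    \<comment> \<open>Here \<open>983775 * 983775 = 967813250625\<close> is less than
      \<open>52954525 * 18551 = 982359393275\<close>.\<close>
    by (intro exI[of _ 74]) (simp add: power2_eq_square)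
qed

end
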